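(* There exists an isometric embedding $\iota:H^2\to\mathcal{P}_1(S^1)$ (i.e. a map with $d_W(\iota(P),\iota(Q))=d_{S^2}(P,Q)$ for all $P,Q\in H^2$) such that $\iota(P)=\delta_P$ for all $P\in S^1$.
   Context: $H^2$ denotes the closed hemisphere of the unit round sphere $S^2$ with the angular (spherical) distance $d_{S^2}$. $S^1$ is its boundary great circle, equipped with the restriction of $d_{S^2}$, which is the arc-length metric $d_{S^1}$ (total length $2\pi$). $\mathcal{P}_1(S^1)$ is the set of Borel probability measures on $S^1$ with the Wasserstein $1$-distance $d_W(\mu,\nu)=\inf_K\int_{S^1\times S^1}d_{S^1}(x,y)\,dK(x,y)$, the infimum over all couplings $K$ of $\mu$ and $\nu$ (Borel probability measures on $S^1\times S^1$ with marginals $\mu$ and $\nu$). $\delta_P$ is the Dirac measure at $P$. *)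

theory Defs
  imports "HOL-Probability.Probability"
begin

definition sphere_dist :: "real ^ 3 \<Rightarrow> real ^ 3 \<Rightarrow> real" where
  "sphere_dist x y = arccos (x \<bullet> y)"

definition hemisphere :: "(real ^ 3) set" where
  "hemisphere = {x \<in> sphere 0 1. x $ 3 \<ge> 0}"

definition boundary_circle :: "(real ^ 3) set" where
  "boundary_circle = {x \<in> sphere 0 1. x $ 3 = 0}"

abbreviation circle_borel :: "(real ^ 3) measure" where
  "circle_borel \<equiv> restrict_space borel boundary_circle"

definition circle_probs :: "(real ^ 3) measure set" where
  "circle_probs = {\<mu>. prob_space \<mu> \<and> sets \<mu> = sets circle_borel}"

text \<open>The circle is second countable, so the Borel sets of its square are the
  product sigma-algebra.\<close>

definition couplings ::
  "(real ^ 3) measure \<Rightarrow> (real ^ 3) measure \<Rightarrow> ((real ^ 3) \<times> (real ^ 3)) measure set" where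
  "couplings \<mu> \<nu> = {K. prob_space K \<and> sets K = sets (circle_borel \<Otimes>\<^sub>M circle_borel) \<and>
     distr K circle_borel fst = \<mu> \<and> distr K circle_borel snd = \<nu>}"

text \<open>For probability measures on the circle the infimum ranges over a nonempty set (it
  contains the product coupling) bounded below by 0, and the integrand is continuous with
  values in \<open>[0, pi]\<close>, hence integrable.\<close>

definition wasserstein1 :: "(real ^ 3) measure \<Rightarrow> (real ^ 3) measure \<Rightarrow> real" where
  "wasserstein1 \<mu> \<nu> =
     (INF K \<in> couplings \<mu> \<nu>. integral\<^sup>L K (\<lambda>z. sphere_dist (fst z) (snd z)))"

end

theory Submission
  imports Defs
begin

text \<open>
  Draw \<open>y = (Y, Z)\<close> uniformly from the unit ball of \<open>\<real>\<^sup>4 = \<complex>\<^sup>2\<close>, write a point \<open>P\<close> of the hemisphere as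
  \<open>(p, h)\<close> with \<open>p \<in> \<complex>\<close> and \<open>h \<ge> 0\<close>, and let \<open>\<iota> P\<close> be the law of the direction of
  \<open>(Y p - h Z) cnj Y\<close>, which is \<open>P\<close> itself when \<open>h = 0\<close>. The same \<open>y\<close> couples \<open>\<iota> P\<close> with
  \<open>\<iota> Q\<close>, and the distance of the two directions is the angle between the complex numbers
  \<open>Y p - h Z\<close> and \<open>Y q - k Z\<close>. An angle is \<open>\<pi>\<close> times the probability that a random line through 0
  separates the two numbers; as the law of \<open>y\<close> is invariant under \<open>y \<mapsto> e\<^sup>i\<^sup>t y\<close>, a fixed line
  does as well on average. Now \<open>Re (Y p - h Z)\<close> is the inner product of \<open>y\<close> with a vector of
  \<open>\<real>\<^sup>4\<close> depending isometrically on \<open>P\<close>, so Crofton's formula in \<open>\<real>\<^sup>4\<close> shows that this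
  coupling costs exactly the distance of \<open>P\<close> and \<open>Q\<close>. It is optimal: if \<open>A\<close> is the end on the equator of the
  geodesic from \<open>Q\<close> through \<open>P\<close>, then \<open>d(A, \<cdot>)\<close> is a 1-Lipschitz potential whose
  means under \<open>\<iota> P\<close> and \<open>\<iota> Q\<close> are \<open>d(A, P)\<close> and \<open>d(A, Q) = d(A, P) + d(P, Q)\<close>.
\<close>

section \<open>Angles in the plane as measures of separating lines\<close>

text \<open>The piece over \<open>{0..<c}\<close> moves by one period to \<open>{T..<c + T}\<close>
  and there completes \<open>{c..<T}\<close> to a full period starting at \<open>c\<close>.\<close>

lemma nn_integral_periodic_shift:
  fixes f :: "real \<Rightarrow> ennreal"
  assumes [measurable]: "f \<in> borel_measurable borel"
    and per: "\<And>x. f (x + T) = f x" and c: "0 \<le> c" "c \<le> T"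
  shows "(\<integral>\<^sup>+s\<in>{0..<T}. f (c + s) \<partial>lborel) = (\<integral>\<^sup>+x\<in>{0..<T}. f x \<partial>lborel)"
proof -
  have "(\<integral>\<^sup>+x\<in>{0..<T}. f x \<partial>lborel)
      = (\<integral>\<^sup>+x\<in>{c..<T}. f x \<partial>lborel) + (\<integral>\<^sup>+x\<in>{0..<c}. f x \<partial>lborel)"
    using c by (subst nn_integral_add[symmetric])
      (auto intro!: nn_integral_cong split: split_indicator)
  also have "(\<integral>\<^sup>+x\<in>{0..<c}. f x \<partial>lborel) = (\<integral>\<^sup>+x. f (-T + x) * indicator {0..<c} (-T + x) \<partial>lborel)"
    using nn_integral_real_affine[of "\<lambda>x. f x * indicator {0..<c} x" 1 "-T"] by simp
  also have "\<dots> = (\<integral>\<^sup>+x\<in>{T..<c + T}. f x \<partial>lborel)"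
    using per[of "-T + x" for x] by (intro nn_integral_cong) (auto split: split_indicator)
  also have "(\<integral>\<^sup>+x\<in>{c..<T}. f x \<partial>lborel) + \<dots> = (\<integral>\<^sup>+x\<in>{c..<c + T}. f x \<partial>lborel)"
    using c by (subst nn_integral_add[symmetric])
      (auto intro!: nn_integral_cong split: split_indicator)
  also have "\<dots> = (\<integral>\<^sup>+s. f (c + s) * indicator {c..<c + T} (c + s) \<partial>lborel)"
    using nn_integral_real_affine[of "\<lambda>x. f x * indicator {c..<c+T} x" 1 c] by simp
  also have "\<dots> = (\<integral>\<^sup>+s\<in>{0..<T}. f (c + s) \<partial>lborel)"
    by (intro nn_integral_cong) (auto split: split_indicator)
  finally show ?thesis by simp
qed

text \<open>\<open>Re (cis (- t) * a)\<close> is the inner product of \<open>a\<close> with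
  \<open>cis t\<close>, so the test is whether the line through 0 orthogonal to \<open>cis t\<close>
  separates \<open>a\<close> from \<open>b\<close>; points on the line count to the nonpositive
  side.\<close>

definition separates :: "real \<Rightarrow> complex \<Rightarrow> complex \<Rightarrow> bool" where
  "separates t a b \<longleftrightarrow> (Re (cis (- t) * a) > 0) \<noteq> (Re (cis (- t) * b) > 0)"

lemma measurable_separates [measurable]:
  assumes [measurable]: "f \<in> borel_measurable M" "a \<in> borel_measurable M" "b \<in> borel_measurable M"
  shows "Measurable.pred M (\<lambda>x. separates (f x) (a x) (b x))"
  unfolding separates_def cis.sel Re_divide times_complex.sel by measurable

lemma sin_pos_iff_0_2pi:
  assumes "- pi \<le> s" "s < 2 * pi"
  shows "sin s > 0 \<longleftrightarrow> 0 < s \<and> s < pi"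
proof -
  have "sin s \<le> 0" if "s \<le> 0"
    using sin_ge_zero[of "- s"] that assms by auto
  moreover have "sin s \<le> 0" if "pi \<le> s"
    using sin_ge_zero[of "s - pi"] that assms by auto
  ultimately show ?thesis
    using sin_gt_zero[of s] by (metis leI linorder_not_less)
qed

text \<open>The factor \<open>\<i>\<close> turns the two tests into \<open>sin (t - c) > 0\<close>
  and \<open>sin (t - (c + d)) > 0\<close>. Each holds on a half circle, and half circles shifted
  against each other by \<open>d\<close> differ in two arcs of length \<open>d\<close>.\<close>

lemma nn_integral_separates_aux:
  assumes r: "r > 0" "r' > 0" and c: "0 \<le> c" "c < 2 * pi" and d: "0 \<le> d" "d \<le> pi"
  shows "(\<integral>\<^sup>+t\<in>{0..<2*pi}. indicator {t. separates t (r *\<^sub>R (\<i> * cis c)) (r' *\<^sub>R (\<i> * cis (c + d)))} t \<partial>lborel)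
    = ennreal (2 * d)"
proof -
  define f :: "real \<Rightarrow> ennreal" where
    "f = indicator {t. separates t (r *\<^sub>R (\<i> * cis c)) (r' *\<^sub>R (\<i> * cis (c + d)))}"
  have Re: "Re (cis (- t) * (r *\<^sub>R (\<i> * cis c))) = r * sin (t - c)" for t r c
    by (simp add: sin_diff algebra_simps)
  have f: "f t = of_bool ((sin (t - c) > 0) \<noteq> (sin (t - (c + d)) > 0))" for t
    unfolding f_def separates_def Re using r by (simp add: indicator_def zero_less_mult_iff)
  have [measurable]: "f \<in> borel_measurable borel"
    unfolding f_def by measurable
  have per: "f (x + 2 * pi) = f x" for x
  proof -
    have "sin (x + 2 * pi - u) = sin (x - u)" for u
      using sin_periodic[of "x - u"] by (simp add: algebra_simps)
    then show ?thesis by (simp add: f)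
  qed
  have f': "f (c + s) = of_bool ((0 < s \<and> s < pi) \<noteq> (d < s \<and> s < d + pi))" if "0 \<le> s" "s < 2 * pi" for s
  proof -
    have "sin s > 0 \<longleftrightarrow> 0 < s \<and> s < pi"
      by (rule sin_pos_iff_0_2pi) (use that in auto)
    moreover have "sin (s - d) > 0 \<longleftrightarrow> 0 < s - d \<and> s - d < pi"
      by (rule sin_pos_iff_0_2pi) (use that d in auto)
    ultimately show ?thesis by (auto simp: f)
  qed
  have "(\<integral>\<^sup>+t\<in>{0..<2*pi}. f t \<partial>lborel) = (\<integral>\<^sup>+s\<in>{0..<2*pi}. f (c + s) \<partial>lborel)"
    by (rule nn_integral_periodic_shift[symmetric]) (use per c in auto)
  also have "\<dots> = (\<integral>\<^sup>+s. indicator {0..d} s + indicator {pi..pi + d} s \<partial>lborel)"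
  proof (rule nn_integral_cong_AE)
    \<comment> \<open>The two sides can differ only at the ends of the arcs, hence the four excluded
      points.\<close>
    show "AE s in lborel. f (c + s) * indicator {0..<2*pi} s
        = indicator {0..d} s + indicator {pi..pi + d} s"
      using AE_lborel_singleton[of 0] AE_lborel_singleton[of d] AE_lborel_singleton[of pi]
        AE_lborel_singleton[of "pi + d"]
    proof eventually_elim
      case (elim s)
      show ?case
      proof (cases "0 \<le> s \<and> s < 2 * pi")
        case True
        then show ?thesis using f'[of s] elim d by (auto simp: indicator_def)
      next
        case False
        then show ?thesis using elim d pi_gt_zero by (auto simp: indicator_def)
      qed
    qed
  qed
  also have "\<dots> = ennreal d + ennreal d"
    using d by (subst nn_integral_add) auto
  also have "\<dots> = ennreal (2 * d)"
    using d by (simp flip: ennreal_plus)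
  finally show ?thesis unfolding f_def .
qed

lemma separates_commute: "separates t a b \<longleftrightarrow> separates t b a"
  by (auto simp: separates_def)

text \<open>The measure is twice the angle because \<open>t\<close> and \<open>t + pi\<close>
  describe the same line.\<close>

lemma nn_integral_separates:
  assumes "a \<noteq> 0" "b \<noteq> 0"
  shows "(\<integral>\<^sup>+t\<in>{0..<2*pi}. indicator {t. separates t a b} t \<partial>lborel)
    = ennreal (2 * arccos (sgn a \<bullet> sgn b))"
proof -
  \<comment> \<open>The argument measured from \<open>\<i>\<close>, to match the form used in
    \<open>nn_integral_separates_aux\<close>.\<close>
  define A where "A z = Arg2pi (- \<i> * z)" for z
  have A: "z = cmod z *\<^sub>R (\<i> * cis (A z))" "0 \<le> A z" "A z < 2 * pi" for z
  proof -
    have "- \<i> * z = cmod z *\<^sub>R cis (A z)"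
      using Arg2pi[of "- \<i> * z"]
      unfolding A_def is_Arg_def by (simp add: norm_mult scaleR_conv_of_real cis_conv_exp)
    then have "\<i> * (- \<i> * z) = \<i> * (cmod z *\<^sub>R cis (A z))"
      by simp
    then show "z = cmod z *\<^sub>R (\<i> * cis (A z))"
      by simp
  qed (use Arg2pi[of "- \<i> * z"] in \<open>auto simp: A_def\<close>)
  have inner: "sgn a \<bullet> sgn b = cos (A b - A a)" if "a \<noteq> 0" "b \<noteq> 0" for a b
  proof -
    have s: "sgn z = \<i> * cis (A z)" if "z \<noteq> 0" for z
    proof -
      have "sgn z = sgn (cmod z *\<^sub>R (\<i> * cis (A z)))"
        using A(1)[of z] by simp
      then show ?thesis using that by (simp add: sgn_div_norm norm_mult)
    qed
    show ?thesis
      unfolding s[OF that(1)] s[OF that(2)] by (simp add: inner_complex_def cos_diff)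
  qed
  have wlog: "(\<integral>\<^sup>+t\<in>{0..<2*pi}. indicator {t. separates t a b} t \<partial>lborel)
      = ennreal (2 * arccos (sgn a \<bullet> sgn b))" if nz: "a \<noteq> 0" "b \<noteq> 0" and le: "A a \<le> A b" for a b
  proof (cases "A b - A a \<le> pi")
    case True
    have "(\<integral>\<^sup>+t\<in>{0..<2*pi}. indicator {t. separates t (cmod a *\<^sub>R (\<i> * cis (A a)))
          (cmod b *\<^sub>R (\<i> * cis (A b)))} t \<partial>lborel) = ennreal (2 * (A b - A a))"
      using nn_integral_separates_aux[of "cmod a" "cmod b" "A a" "A b - A a"] True nz le A(2,3)[of a]
      by simp
    also have "A b - A a = arccos (sgn a \<bullet> sgn b)"
      using le True by (simp add: inner[OF nz] arccos_cos)
    finally show ?thesis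
      unfolding A(1)[symmetric] .
  next
    case False
    \<comment> \<open>The arc from \<open>a\<close> to \<open>b\<close> is longer than
      \<open>pi\<close>, so the angle is that of the complementary arc, which starts at
      \<open>b\<close> and reaches \<open>a\<close> one full turn later.\<close>
    define d where "d = 2 * pi - (A b - A a)"
    have "A b + d = A a + 2 * pi" by (simp add: d_def)
    then have cis: "cis (A b + d) = cis (A a)"
      by (simp add: complex_eq_iff)
    have "0 \<le> d" "d \<le> pi"
      using False le A(2,3)[of a] A(2,3)[of b] by (auto simp: d_def)
    then have "(\<integral>\<^sup>+t\<in>{0..<2*pi}. indicator {t. separates t (cmod b *\<^sub>R (\<i> * cis (A b)))
          (cmod a *\<^sub>R (\<i> * cis (A a)))} t \<partial>lborel) = ennreal (2 * d)"
      using nn_integral_separates_aux[of "cmod b" "cmod a" "A b" d] nz A(2,3)[of b]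
      unfolding cis by simp
    also have "d = arccos (cos d)"
      using \<open>0 \<le> d\<close> \<open>d \<le> pi\<close> by (simp add: arccos_cos)
    also have "cos d = sgn a \<bullet> sgn b"
      by (simp add: inner[OF nz] d_def cos_diff[of "2 * pi"])
    finally show ?thesis
      unfolding A(1)[symmetric] by (subst separates_commute)
  qed
  show ?thesis
  proof (cases "A a \<le> A b")
    case True
    then show ?thesis using wlog assms by blast
  next
    case False
    then show ?thesis
      using wlog[of b a] assms by (simp add: inner_commute separates_commute)
  qed
qed

lemma arccos_clamped:
  assumes "\<bar>u\<bar> \<le> 1"
  shows "arccos u = arccos (max (-1) (min 1 u))"
  using assms by simp

text \<open>Clamping the argument to \<open>{-1..1}\<close> gives a continuous function on the whole
  line that agrees with \<open>arccos\<close> at all values of \<open>f\<close>.\<close>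

lemma borel_measurable_arccos:
  fixes f :: "'a \<Rightarrow> real"
  assumes [measurable]: "f \<in> borel_measurable M" and f: "\<And>x. x \<in> space M \<Longrightarrow> \<bar>f x\<bar> \<le> 1"
  shows "(\<lambda>x. arccos (f x)) \<in> borel_measurable M"
proof -
  have "continuous_on UNIV (\<lambda>u::real. arccos (max (-1) (min 1 u)))"
    by (intro continuous_intros) auto
  then have [measurable]: "(\<lambda>u::real. arccos (max (-1) (min 1 u))) \<in> borel_measurable borel"
    by (rule borel_measurable_continuous_onI)
  have "(\<lambda>x. arccos (max (-1) (min 1 (f x)))) \<in> borel_measurable M"
    by measurable
  then show ?thesis
    by (rule measurable_cong[THEN iffD1, rotated]) (metis arccos_clamped f)
qed

lemma abs_inner_sgn_le_1: "\<bar>sgn a \<bullet> sgn b\<bar> \<le> (1::real)"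
proof -
  have "\<bar>sgn a \<bullet> sgn b\<bar> \<le> norm (sgn a) * norm (sgn b)"
    by (rule Cauchy_Schwarz_ineq2)
  also have "\<dots> \<le> 1" by (simp add: norm_sgn)
  finally show ?thesis .
qed

text \<open>Averaging over \<open>t\<close> turns the half plane into an angle; invariance
  of \<open>M\<close> makes the average over \<open>t\<close> superfluous.\<close>
lemma (in prob_space) rotation_averaging:
  fixes a b :: "'a \<Rightarrow> complex"
  assumes [measurable]: "a \<in> borel_measurable M" "b \<in> borel_measurable M"
    and Rm [measurable]: "\<And>t. R t \<in> M \<rightarrow>\<^sub>M M" and R: "\<And>t. distr M M (R t) = M"
    and aR: "\<And>t y. a (R t y) = cis (- t) * a y" and bR: "\<And>t y. b (R t y) = cis (- t) * b y"
    and nz: "AE y in M. a y \<noteq> 0 \<and> b y \<noteq> 0"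
  shows "expectation (\<lambda>y. arccos (sgn (a y) \<bullet> sgn (b y)))
    = pi * prob {y \<in> space M. (Re (a y) > 0) \<noteq> (Re (b y) > 0)}"
proof -
  define D where "D = {y \<in> space M. (Re (a y) > 0) \<noteq> (Re (b y) > 0)}"
  have D [measurable]: "D \<in> sets M" unfolding D_def by measurable
  let ?f = "\<lambda>t y. indicator {0..<2*pi} t * indicator {(t, y). separates t (a y) (b y)} (t, y) :: ennreal"
  interpret pair_sigma_finite lborel M ..
  have ang: "0 \<le> arccos (sgn (a y) \<bullet> sgn (b y))" for y
    using abs_inner_sgn_le_1[of "a y" "b y"] by (intro arccos_lbound) auto
  have [measurable]: "(\<lambda>y. arccos (sgn (a y) \<bullet> sgn (b y))) \<in> borel_measurable M"
    by (rule borel_measurable_arccos) (use abs_inner_sgn_le_1 in auto)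
  have "ennreal 2 * (\<integral>\<^sup>+y. ennreal (arccos (sgn (a y) \<bullet> sgn (b y))) \<partial>M)
      = (\<integral>\<^sup>+y. ennreal (2 * arccos (sgn (a y) \<bullet> sgn (b y))) \<partial>M)"
    by (subst nn_integral_cmult[symmetric]) (auto simp: ang ennreal_mult')
  also have "\<dots> = (\<integral>\<^sup>+y. \<integral>\<^sup>+t. ?f t y \<partial>lborel \<partial>M)"
  proof (rule nn_integral_cong_AE, use nz in eventually_elim)
    case (elim y)
    have "(\<integral>\<^sup>+t. ?f t y \<partial>lborel)
        = (\<integral>\<^sup>+t\<in>{0..<2*pi}. indicator {t. separates t (a y) (b y)} t \<partial>lborel)"
      by (rule nn_integral_cong) (simp add: indicator_def)
    with elim show ?case
      by (simp only: nn_integral_separates not_False_eq_True)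
  qed
  also have "\<dots> = (\<integral>\<^sup>+t. \<integral>\<^sup>+y. ?f t y \<partial>M \<partial>lborel)"
    by (rule Fubini') measurable
  also have "\<dots> = (\<integral>\<^sup>+t. indicator {0..<2*pi} t * emeasure M D \<partial>lborel)"
  proof (rule nn_integral_cong)
    fix t
    \<comment> \<open>By equivariance of \<open>a\<close> and \<open>b\<close>,
      \<open>separates t (a y) (b y)\<close> says that \<open>R t y\<close> lies in
      \<open>D\<close>, an event whose probability does not depend on \<open>t\<close>.\<close>
    have "(\<integral>\<^sup>+y. ?f t y \<partial>M) = indicator {0..<2*pi} t * (\<integral>\<^sup>+y. indicator D (R t y) \<partial>M)"
      by (subst nn_integral_cmult[symmetric])
        (auto intro!: nn_integral_cong measurable_space[OF Rm]
          simp: indicator_def D_def separates_def aR bR)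
    also have "(\<integral>\<^sup>+y. indicator D (R t y) \<partial>M) = (\<integral>\<^sup>+y. indicator D y \<partial>distr M M (R t))"
      by (subst nn_integral_distr) auto
    also have "\<dots> = emeasure M D"
      by (simp add: R)
    finally show "(\<integral>\<^sup>+y. ?f t y \<partial>M) = indicator {0..<2*pi} t * emeasure M D" .
  qed
  also have "\<dots> = ennreal 2 * ennreal (pi * prob D)"
    by (subst nn_integral_multc) (auto simp: emeasure_eq_measure ennreal_mult'' mult.assoc)
  finally have "(\<integral>\<^sup>+y. ennreal (arccos (sgn (a y) \<bullet> sgn (b y))) \<partial>M) = ennreal (pi * prob D)"
    by (simp add: ennreal_mult_cancel_left)
  then show ?thesis
    unfolding D_def[symmetric] using ang
    by (subst integral_eq_nn_integral) simp_all
qed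

section \<open>The uniform law on the ball and its invariance\<close>

text \<open>Lebesgue measure on the ball supplies what the argument rests on: a probability measure
  that is invariant under orthogonal maps and vanishes on hyperplanes through 0.\<close>

definition ball_measure :: "(real^'n) measure" where
  "ball_measure = uniform_measure lborel (ball 0 1)"

lemma sets_ball_measure [measurable_cong, simp]: "sets ball_measure = sets borel"
  by (simp add: ball_measure_def)

lemma space_ball_measure [simp]: "space ball_measure = UNIV"
  by (simp add: ball_measure_def)

lemma emeasure_lborel_unit_ball:
  "emeasure lborel (ball 0 1 :: 'a::euclidean_space set) \<noteq> 0"
  "emeasure lborel (ball 0 1 :: 'a::euclidean_space set) \<noteq> \<infinity>"
proof -
  have "ball 0 1 \<notin> null_sets (lborel :: 'a measure)"
    using open_not_negligible[of "ball 0 1 :: 'a set"] null_sets_completionI[of "ball 0 1 :: 'a set"]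
    by (auto simp: negligible_iff_null_sets)
  then show "emeasure lborel (ball 0 1 :: 'a set) \<noteq> 0"
    by (simp add: null_sets_def)
  show "emeasure lborel (ball 0 1 :: 'a set) \<noteq> \<infinity>"
    using emeasure_bounded_finite[of "ball 0 1 :: 'a set"] by (metis bounded_ball less_irrefl infinity_ennreal_def)
qed

interpretation ball_measure: prob_space ball_measure
  unfolding ball_measure_def
  by (rule prob_space_uniform_measure) (rule emeasure_lborel_unit_ball)+

text \<open>\<open>R\<close> maps the ball onto itself and preserves volume, so the preimage of
  \<open>A\<close> has the same volume inside the ball as \<open>A\<close>.\<close>

lemma distr_ball_measure_orthogonal:
  fixes R :: "real^'n::{finite,wellorder} \<Rightarrow> real^'n::_"
  assumes R: "orthogonal_transformation R"
  shows "distr ball_measure ball_measure R = ball_measure"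
proof (rule measure_eqI)
  have lin: "linear R" using R by (rule orthogonal_transformation_linear)
  have [measurable]: "R \<in> borel_measurable borel"
    using lin by (intro borel_measurable_continuous_onI linear_continuous_on) (simp add: linear_conv_bounded_linear)
  fix A assume "A \<in> sets (distr ball_measure ball_measure R)"
  then have A [measurable]: "A \<in> sets borel" by simp
  have RA [measurable]: "R -` A \<in> sets borel"
    using measurable_sets[of R borel borel A] by simp
  define S where "S = ball 0 1 \<inter> R -` A"
  have S [measurable]: "S \<in> sets borel"
    unfolding S_def by measurable
  have fin: "emeasure lborel T \<noteq> \<infinity>" if "T \<subseteq> ball 0 1" for T :: "(real^'n::{finite,wellorder}) set"
    using emeasure_bounded_finite[OF bounded_subset[OF bounded_ball that]] by simp
  have Sm: "S \<in> lmeasurable"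
  proof (rule bounded_set_imp_lmeasurable)
    show "bounded S" unfolding S_def by (rule bounded_subset[OF bounded_ball]) (rule Int_lower1)
    show "S \<in> sets lebesgue" using S by (auto intro: sets_completionI_sets)
  qed
  have im: "R ` S = ball 0 1 \<inter> A"
  proof -
    have "R ` S = R ` ball 0 1 \<inter> A"
      unfolding S_def by auto
    then show ?thesis
      using image_orthogonal_transformation_ball[OF R, of 0 1] lin by (simp add: linear_0)
  qed
  have "measure lborel S = measure lborel (ball 0 1 \<inter> A)"
    using measure_orthogonal_image[OF R Sm] by (simp add: im measure_completion)
  then have "emeasure lborel S = emeasure lborel (ball 0 1 \<inter> A)"
    using fin[of S] fin[of "ball 0 1 \<inter> A"]
    by (simp add: emeasure_eq_ennreal_measure S_def)
  then show "emeasure (distr ball_measure ball_measure R) A = emeasure ball_measure A"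
    by (simp add: emeasure_distr) (simp add: ball_measure_def S_def A RA)
qed simp

lemma AE_ball_measure_hyperplane:
  fixes u :: "real^'n"
  assumes "u \<noteq> 0"
  shows "AE y in ball_measure. y \<bullet> u \<noteq> 0"
proof -
  have "negligible {y. u \<bullet> y = 0}"
    using assms by (intro negligible_hyperplane) auto
  moreover have "{y. u \<bullet> y = 0} \<in> sets borel"
    by measurable
  ultimately have "{y. u \<bullet> y = 0} \<in> null_sets lborel"
    by (auto simp: negligible_iff_null_sets null_sets_def)
  then have "AE y in lborel. y \<notin> {y. u \<bullet> y = 0}"
    by (rule AE_not_in)
  then show ?thesis
    unfolding ball_measure_def
    by (intro AE_uniform_measureI) (auto simp: inner_commute elim: eventually_mono)
qed

section \<open>Great circles and Crofton's formula\<close>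

text \<open>The pair of coordinates along \<open>p\<close> and \<open>n\<close>, read as a complex
  number, is multiplied by \<open>cis (- t)\<close>, as \<open>rotation_averaging\<close> requires.
  \<open>A\<close> and \<open>B\<close> are the changes of the two coordinates; the orthogonal
  complement of the plane stays fixed.\<close>

lemma plane_rotation:
  fixes p n :: "'a::real_inner"
  assumes p: "norm p = 1" and n: "norm n = 1" and pn: "p \<bullet> n = 0"
  obtains R where "orthogonal_transformation R"
    "\<And>y. R y \<bullet> p = cos t * (y \<bullet> p) + sin t * (y \<bullet> n)"
    "\<And>y. R y \<bullet> n = - sin t * (y \<bullet> p) + cos t * (y \<bullet> n)"
proof
  define A where "A y = (cos t - 1) * (y \<bullet> p) + sin t * (y \<bullet> n)" for y
  define B where "B y = - sin t * (y \<bullet> p) + (cos t - 1) * (y \<bullet> n)" for y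
  define R where "R y = y + A y *\<^sub>R p + B y *\<^sub>R n" for y
  have one: "p \<bullet> p = 1" "n \<bullet> n = 1" "n \<bullet> p = 0"
    using p n pn by (auto simp: dot_square_norm inner_commute)
  have "linear R"
    unfolding R_def A_def B_def
    by (intro linearI) (simp_all add: algebra_simps inner_add_left)
  moreover have "norm (R y) = norm y" for y
  proof -
    have "R y \<bullet> R y = y \<bullet> y + ((A y)\<^sup>2 + (B y)\<^sup>2 + 2 * A y * (y \<bullet> p) + 2 * B y * (y \<bullet> n))"
      using one pn by (simp add: R_def inner_add_left inner_add_right inner_commute algebra_simps power2_eq_square)
    also have "(A y)\<^sup>2 + (B y)\<^sup>2 + 2 * A y * (y \<bullet> p) + 2 * B y * (y \<bullet> n)
        = ((sin t)\<^sup>2 + (cos t)\<^sup>2 - 1) * ((y \<bullet> p)\<^sup>2 + (y \<bullet> n)\<^sup>2)"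
      unfolding A_def B_def by algebra
    finally show ?thesis by (simp add: norm_eq)
  qed
  ultimately show "orthogonal_transformation R"
    by (simp add: orthogonal_transformation)
  show "R y \<bullet> p = cos t * (y \<bullet> p) + sin t * (y \<bullet> n)" for y
    using one pn by (simp add: R_def A_def inner_add_left algebra_simps)
  show "R y \<bullet> n = - sin t * (y \<bullet> p) + cos t * (y \<bullet> n)" for y
    using one pn by (simp add: R_def B_def inner_add_left algebra_simps)
qed

lemma abs_inner_unit:
  assumes "norm p = 1" "norm q = 1"
  shows "\<bar>p \<bullet> q\<bar> \<le> 1"
  using Cauchy_Schwarz_ineq2[of p q] assms by simp

text \<open>\<open>n\<close> is the normalized component of \<open>q\<close> orthogonal to
  \<open>p\<close>. If \<open>q\<close> is \<open>p\<close> or \<open>- p\<close> this component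
  vanishes and any unit vector orthogonal to \<open>p\<close> serves, which is where the dimension
  enters.\<close>

lemma unit_great_circle:
  fixes p q :: "'a::euclidean_space"
  assumes p: "norm p = 1" and q: "norm q = 1" and dim: "2 \<le> DIM('a)"
  obtains n where "norm n = 1" "p \<bullet> n = 0"
    "q = cos (arccos (p \<bullet> q)) *\<^sub>R p + sin (arccos (p \<bullet> q)) *\<^sub>R n"
proof -
  define c where "c = p \<bullet> q"
  define s where "s = sqrt (1 - c\<^sup>2)"
  have c: "\<bar>c\<bar> \<le> 1" unfolding c_def using p q by (rule abs_inner_unit)
  have cs: "cos (arccos c) = c" "sin (arccos c) = s"
    using c by (auto simp: s_def cos_arccos_abs sin_arccos_abs)
  have pp: "p \<bullet> p = 1" "q \<bullet> q = 1"
    using p q by (auto simp: dot_square_norm)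
  have r: "norm (q - c *\<^sub>R p) = s"
    unfolding s_def norm_eq_sqrt_inner
    by (simp add: inner_diff_left inner_diff_right pp inner_commute c_def power2_eq_square algebra_simps)
  show thesis
  proof (cases "s = 0")
    case True
    obtain x where "x \<noteq> 0" "orthogonal p x"
      using orthogonal_to_vector_exists[OF dim, of p] by auto
    moreover have "q = c *\<^sub>R p"
      using True r by simp
    ultimately show ?thesis
      using that[of "sgn x"] cs True
      unfolding c_def[symmetric] by (simp add: norm_sgn sgn_div_norm orthogonal_def)
  next
    case False
    show ?thesis
    proof (rule that[of "(1 / s) *\<^sub>R (q - c *\<^sub>R p)"])
      show "norm ((1 / s) *\<^sub>R (q - c *\<^sub>R p)) = 1"
        using r False norm_ge_zero[of "q - c *\<^sub>R p"] by simp
      show "p \<bullet> (1 / s) *\<^sub>R (q - c *\<^sub>R p) = 0"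
        using pp by (simp add: inner_diff_right c_def)
      show "q = cos (arccos (p \<bullet> q)) *\<^sub>R p + sin (arccos (p \<bullet> q)) *\<^sub>R (1 / s) *\<^sub>R (q - c *\<^sub>R p)"
        unfolding c_def[symmetric] cs using False by simp
    qed
  qed
qed

text \<open>The complex numbers \<open>a y\<close> and \<open>b y\<close> have real parts
  \<open>y \<bullet> p\<close> and \<open>y \<bullet> q\<close> and almost surely enclose the
  constant angle \<open>d\<close>. Hence the expectation in \<open>rotation_averaging\<close> is
  \<open>d\<close>, and the lemma yields the probability.\<close>

lemma crofton:
  fixes p q :: "real^'n::{finite,wellorder}"
  assumes p: "norm p = 1" and q: "norm q = 1" and dim: "2 \<le> CARD('n)"
  shows "pi * ball_measure.prob {y. (y \<bullet> p > 0) \<noteq> (y \<bullet> q > 0)} = arccos (p \<bullet> q)"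
proof -
  define d where "d = arccos (p \<bullet> q)"
  have dim': "2 \<le> DIM(real^'n::{finite,wellorder})" using dim by simp
  obtain n where n: "norm n = 1" "p \<bullet> n = 0" and q_eq: "q = cos d *\<^sub>R p + sin d *\<^sub>R n"
    unfolding d_def by (rule unit_great_circle[OF p q dim'])
  define a where "a y = Complex (y \<bullet> p) (y \<bullet> n)" for y
  define b where "b y = cis (- d) * a y" for y
  have "\<forall>t. \<exists>R. orthogonal_transformation R
      \<and> (\<forall>y. R y \<bullet> p = cos t * (y \<bullet> p) + sin t * (y \<bullet> n))
      \<and> (\<forall>y. R y \<bullet> n = - sin t * (y \<bullet> p) + cos t * (y \<bullet> n))"
    using plane_rotation[OF p n] by metis
  then obtain R where R: "\<And>t. orthogonal_transformation (R t)"
    and Rp: "\<And>t y. R t y \<bullet> p = cos t * (y \<bullet> p) + sin t * (y \<bullet> n)"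
    and Rn: "\<And>t y. R t y \<bullet> n = - sin t * (y \<bullet> p) + cos t * (y \<bullet> n)"
    by metis
  have am [measurable]: "a \<in> borel_measurable borel"
    unfolding a_def by (auto intro!: borel_measurable_continuous_onI continuous_intros)
  have aR: "a (R t y) = cis (- t) * a y" for t y
    by (simp add: a_def Rp Rn complex_eq_iff)
  have nz: "AE y in ball_measure. a y \<noteq> 0"
  proof -
    have "p \<noteq> 0" using p by auto
    from AE_ball_measure_hyperplane[OF this] show ?thesis
      by (rule eventually_mono) (auto simp: a_def complex_eq_iff)
  qed
  have "ball_measure.expectation (\<lambda>y. arccos (sgn (a y) \<bullet> sgn (b y)))
      = pi * ball_measure.prob {y \<in> space ball_measure. (Re (a y) > 0) \<noteq> (Re (b y) > 0)}"
  proof (rule ball_measure.rotation_averaging)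
    show "R t \<in> ball_measure \<rightarrow>\<^sub>M ball_measure" for t
      using orthogonal_transformation_linear[OF R]
      by (simp add: measurable_cong_sets[OF sets_ball_measure sets_ball_measure]
        borel_measurable_continuous_onI linear_continuous_on linear_conv_bounded_linear)
    show "distr ball_measure ball_measure (R t) = ball_measure" for t
      using R by (rule distr_ball_measure_orthogonal)
    show "AE y in ball_measure. a y \<noteq> 0 \<and> b y \<noteq> 0"
      using nz by (auto simp: b_def elim: eventually_mono)
  qed (auto simp: b_def aR mult.left_commute)
  moreover have "ball_measure.expectation (\<lambda>y. arccos (sgn (a y) \<bullet> sgn (b y))) = d"
  proof -
    have "sgn z \<bullet> sgn (cis (- d) * z) = cos d" if "z \<noteq> 0" for z
    proof -
      have "sgn z \<bullet> (cis (- d) * sgn z) = cos d * (sgn z \<bullet> sgn z)"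
        by (simp add: inner_complex_def algebra_simps)
      then show ?thesis using that by (simp add: sgn_mult sgn_cis dot_square_norm norm_sgn)
    qed
    moreover have "arccos (cos d) = d"
      using abs_inner_unit[OF p q] by (simp add: d_def cos_arccos_abs)
    ultimately have ae: "AE y in ball_measure. arccos (sgn (a y) \<bullet> sgn (b y)) = d"
      using nz by (auto simp: b_def elim: eventually_mono)
    have [measurable]: "(\<lambda>y. arccos (sgn (a y) \<bullet> sgn (b y))) \<in> borel_measurable ball_measure"
      by (rule borel_measurable_arccos) (auto simp: b_def abs_inner_sgn_le_1)
    show ?thesis
      by (subst integral_cong_AE[OF _ _ ae]) (simp_all add: ball_measure.prob_space[simplified])
  qed
  moreover have "Re (a y) = y \<bullet> p" "Re (b y) = y \<bullet> q" for y
    by (simp_all add: a_def b_def q_eq inner_add_right)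
  ultimately show ?thesis by (simp add: d_def)
qed

section \<open>Complex coordinates on \<open>\<real>\<^sup>4\<close> and the linear form of a
  point\<close>

lemma vector_4 [simp]:
  "(vector [a, b, c, d] :: 'a::zero^4) $ 1 = a"
  "(vector [a, b, c, d] :: 'a::zero^4) $ 2 = b"
  "(vector [a, b, c, d] :: 'a::zero^4) $ 3 = c"
  "(vector [a, b, c, d] :: 'a::zero^4) $ 4 = d"
  unfolding vector_def by simp_all

definition fst_complex :: "real^4 \<Rightarrow> complex" where
  "fst_complex y = Complex (y $ 1) (y $ 2)"

definition snd_complex :: "real^4 \<Rightarrow> complex" where
  "snd_complex y = Complex (y $ 3) (y $ 4)"

text \<open>Scalar multiplication by \<open>cis (- t)\<close> on \<open>\<complex>\<^sup>2\<close>,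
  in real coordinates.\<close>

definition phase_rotation :: "real \<Rightarrow> real^4 \<Rightarrow> real^4" where
  "phase_rotation t y = vector
    [cos t * y $ 1 + sin t * y $ 2, cos t * y $ 2 - sin t * y $ 1,
     cos t * y $ 3 + sin t * y $ 4, cos t * y $ 4 - sin t * y $ 3]"

lemma orthogonal_phase_rotation: "orthogonal_transformation (phase_rotation t)"
proof -
  have "linear (phase_rotation t)"
    by (intro linearI) (simp_all add: vec_eq_iff forall_4 phase_rotation_def algebra_simps)
  moreover have "norm (phase_rotation t y) = norm y" for y
  proof -
    have "phase_rotation t y \<bullet> phase_rotation t y
        = ((cos t)\<^sup>2 + (sin t)\<^sup>2) * (y \<bullet> y)"
      by (simp only: inner_vec_def sum_4 phase_rotation_def vector_4 inner_real_def) algebra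
    then show ?thesis by (simp add: norm_eq)
  qed
  ultimately show ?thesis by (simp add: orthogonal_transformation)
qed

lemma phase_rotation_complex:
  "fst_complex (phase_rotation t y) = cis (- t) * fst_complex y"
  "snd_complex (phase_rotation t y) = cis (- t) * snd_complex y"
  by (simp_all add: fst_complex_def snd_complex_def phase_rotation_def complex_eq_iff)

definition complex_form :: "real^3 \<Rightarrow> real^4 \<Rightarrow> complex" where
  "complex_form P y = fst_complex y * Complex (P $ 1) (P $ 2) - P $ 3 *\<^sub>R snd_complex y"

text \<open>Represents the real part of \<open>complex_form P\<close> as an inner product: the first
  minus sign comes from the product of complex numbers, the second from the sign before
  \<open>snd_complex y\<close>, and the final 0 from \<open>P $ 3\<close> being real.\<close>

definition covector :: "real^3 \<Rightarrow> real^4" where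
  "covector P = vector [P $ 1, - P $ 2, - P $ 3, 0]"

lemma Re_complex_form: "Re (complex_form P y) = y \<bullet> covector P"
  by (simp add: complex_form_def covector_def fst_complex_def snd_complex_def inner_vec_def sum_4)

lemma inner_covector: "covector P \<bullet> covector Q = P \<bullet> Q"
  by (simp add: covector_def inner_vec_def sum_4 sum_3)

lemma norm_covector: "norm (covector P) = norm P"
  by (simp add: norm_eq_sqrt_inner inner_covector)

lemma complex_form_phase_rotation: "complex_form P (phase_rotation t y) = cis (- t) * complex_form P y"
  by (simp add: complex_form_def phase_rotation_complex algebra_simps)

lemma continuous_on_fst_complex: "continuous_on A fst_complex"
  unfolding fst_complex_def complex_eq by (intro continuous_intros)

lemma measurable_fst_complex [measurable]: "fst_complex \<in> borel_measurable borel"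
  by (rule borel_measurable_continuous_onI) (rule continuous_on_fst_complex)

lemma measurable_complex_form [measurable]: "complex_form P \<in> borel_measurable borel"
proof (rule borel_measurable_continuous_onI)
  show "continuous_on UNIV (complex_form P)"
    unfolding complex_form_def fst_complex_def snd_complex_def complex_eq by (intro continuous_intros)
qed

section \<open>Random directions on the circle\<close>

text \<open>The value at 0 is an arbitrary point of the circle, so that the map is total; in
  \<open>shadow P\<close> with \<open>P\<close> a unit vector the argument vanishes only on a null
  set.\<close>

definition circle_point :: "complex \<Rightarrow> real^3" where
  "circle_point w = (if w = 0 then axis 1 1 else Re (sgn w) *\<^sub>R axis 1 1 + Im (sgn w) *\<^sub>R axis 2 1)"

lemma circle_point_nth:
  "w \<noteq> 0 \<Longrightarrow> circle_point w $ 1 = Re (sgn w)"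
  "w \<noteq> 0 \<Longrightarrow> circle_point w $ 2 = Im (sgn w)"
  "circle_point w $ 3 = 0"
  by (simp_all add: circle_point_def axis_def)

lemma inner_circle_point:
  assumes "w \<noteq> 0" "z \<noteq> 0"
  shows "circle_point w \<bullet> circle_point z = sgn w \<bullet> sgn z"
  using assms by (simp add: inner_vec_def sum_3 circle_point_nth inner_complex_def)

lemma circle_point_in_circle: "circle_point w \<in> boundary_circle"
proof (cases "w = 0")
  case True
  then have "norm (circle_point w) = 1"
    by (simp add: circle_point_def norm_axis_1)
  then show ?thesis by (simp add: boundary_circle_def circle_point_nth)
next
  case False
  have "norm (circle_point w) = sqrt (sgn w \<bullet> sgn w)"
    unfolding norm_eq_sqrt_inner inner_circle_point[OF False False] ..
  also have "\<dots> = 1"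
    using False by (simp add: dot_square_norm norm_sgn)
  finally show ?thesis by (simp add: boundary_circle_def circle_point_nth)
qed

lemma measurable_circle_point [measurable]: "circle_point \<in> borel \<rightarrow>\<^sub>M circle_borel"
proof (rule measurable_restrict_space2)
  show "circle_point \<in> borel_measurable borel"
    unfolding circle_point_def by measurable
qed (simp add: circle_point_in_circle)

text \<open>In the gnomonic chart of the hemisphere, this projects \<open>P\<close> from the random point
  \<open>snd_complex y / fst_complex y\<close> to the circle at infinity.\<close>
definition shadow :: "real^3 \<Rightarrow> real^4 \<Rightarrow> real^3" where
  "shadow P y = circle_point (complex_form P y * cnj (fst_complex y))"

definition embedding :: "real^3 \<Rightarrow> (real^3) measure" where
  "embedding P = distr ball_measure circle_borel (shadow P)"

lemma measurable_cnj [measurable]: "cnj \<in> borel_measurable borel"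
  by (intro borel_measurable_continuous_onI continuous_intros)

lemma measurable_shadow [measurable]: "shadow P \<in> ball_measure \<rightarrow>\<^sub>M circle_borel"
  unfolding shadow_def by measurable

lemma AE_complex_form_nonzero:
  assumes "norm P = 1"
  shows "AE y in ball_measure. complex_form P y \<noteq> 0"
proof -
  have "covector P \<noteq> 0" using assms norm_covector[of P] by auto
  from AE_ball_measure_hyperplane[OF this] show ?thesis
    by (rule eventually_mono) (auto simp flip: Re_complex_form)
qed

lemma AE_fst_complex_nonzero: "AE y in ball_measure. fst_complex y \<noteq> 0"
proof -
  have "AE y in ball_measure. y \<bullet> (axis 1 1 :: real^4) \<noteq> 0"
    by (rule AE_ball_measure_hyperplane) (simp add: axis_eq_0_iff)
  then show ?thesis
    by (rule eventually_mono) (auto simp: fst_complex_def complex_eq_iff inner_axis)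
qed

text \<open>Both shadows carry the same factor \<open>cnj (fst_complex y)\<close>, whose direction
  acts as a rotation of the plane and so preserves inner products.\<close>

lemma inner_shadow:
  assumes "complex_form P y \<noteq> 0" "complex_form Q y \<noteq> 0" "fst_complex y \<noteq> 0"
  shows "shadow P y \<bullet> shadow Q y = sgn (complex_form P y) \<bullet> sgn (complex_form Q y)"
proof -
  have rot: "(a * u) \<bullet> (b * u) = (cmod u)\<^sup>2 * (a \<bullet> b)" for a b u :: complex
    unfolding cmod_power2 inner_complex_def times_complex.sel by algebra
  show ?thesis
    using assms
    by (simp add: shadow_def inner_circle_point sgn_mult rot norm_sgn)
qed

section \<open>Measurability and mean of the spherical distance\<close>

lemma circle_unit: "x \<in> boundary_circle \<Longrightarrow> norm x = 1"
  by (simp add: boundary_circle_def)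

lemma hemisphere_unit: "x \<in> hemisphere \<Longrightarrow> norm x = 1"
  by (simp add: hemisphere_def)

lemma space_circle_borel [simp]: "space circle_borel = boundary_circle"
  by (simp add: space_restrict_space)

lemma measurable_sphere_dist:
  assumes "f \<in> M \<rightarrow>\<^sub>M circle_borel" "g \<in> M \<rightarrow>\<^sub>M circle_borel"
  shows "(\<lambda>x. sphere_dist (f x) (g x)) \<in> borel_measurable M"
  unfolding sphere_dist_def
proof (rule borel_measurable_arccos)
  have [measurable]: "f \<in> borel_measurable M" "g \<in> borel_measurable M"
    using assms by (simp_all add: measurable_restrict_space2_iff)
  show "(\<lambda>x. f x \<bullet> g x) \<in> borel_measurable M" by measurable
  fix x assume "x \<in> space M"
  then show "\<bar>f x \<bullet> g x\<bar> \<le> 1"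
    using assms[THEN measurable_space] by (simp add: abs_inner_unit circle_unit)
qed

lemma sphere_dist_bounds:
  assumes "norm x = 1" "norm y = 1"
  shows "0 \<le> sphere_dist x y" "sphere_dist x y \<le> pi"
  using abs_inner_unit[OF assms] by (auto simp: sphere_dist_def intro: arccos_lbound arccos_ubound)

lemma integrable_sphere_dist:
  assumes "prob_space M" and f: "f \<in> M \<rightarrow>\<^sub>M circle_borel" and g: "g \<in> M \<rightarrow>\<^sub>M circle_borel"
  shows "integrable M (\<lambda>x. sphere_dist (f x) (g x))"
proof -
  interpret prob_space M by fact
  show ?thesis
  proof (rule integrable_const_bound[where B = pi])
    have "norm (sphere_dist (f x) (g x)) \<le> pi" if "x \<in> space M" for x
      using sphere_dist_bounds[OF circle_unit circle_unit, of "f x" "g x"]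
        measurable_space[OF f that] measurable_space[OF g that]
      by simp
    then show "AE x in M. norm (sphere_dist (f x) (g x)) \<le> pi" by simp
  qed (rule measurable_sphere_dist[OF f g])
qed

text \<open>The cost of using the same \<open>y\<close> for both points. Invariance under
  \<open>phase_rotation\<close> reduces the angle between the two forms to the signs of their real
  parts; these are inner products with covectors, to which \<open>crofton\<close> applies.\<close>

lemma expectation_sphere_dist_shadow:
  assumes P: "norm P = 1" and Q: "norm Q = 1"
  shows "ball_measure.expectation (\<lambda>y. sphere_dist (shadow P y) (shadow Q y)) = sphere_dist P Q"
proof -
  have nz: "AE y in ball_measure. complex_form P y \<noteq> 0 \<and> complex_form Q y \<noteq> 0 \<and> fst_complex y \<noteq> 0"
    using AE_complex_form_nonzero[OF P] AE_complex_form_nonzero[OF Q] AE_fst_complex_nonzero by eventually_elim simp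
  then have ae: "AE y in ball_measure. sphere_dist (shadow P y) (shadow Q y)
      = arccos (sgn (complex_form P y) \<bullet> sgn (complex_form Q y))"
    by (rule eventually_mono) (simp add: sphere_dist_def inner_shadow)
  have [measurable]: "(\<lambda>y. arccos (sgn (complex_form P y) \<bullet> sgn (complex_form Q y))) \<in> borel_measurable ball_measure"
    by (rule borel_measurable_arccos) (auto simp: abs_inner_sgn_le_1)
  have "ball_measure.expectation (\<lambda>y. sphere_dist (shadow P y) (shadow Q y))
      = ball_measure.expectation (\<lambda>y. arccos (sgn (complex_form P y) \<bullet> sgn (complex_form Q y)))"
    by (rule integral_cong_AE[OF measurable_sphere_dist _ ae]) simp_all
  also have "\<dots> = pi * ball_measure.prob
      {y \<in> space ball_measure. (Re (complex_form P y) > 0) \<noteq> (Re (complex_form Q y) > 0)}"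
  proof (rule ball_measure.rotation_averaging)
    show "phase_rotation t \<in> ball_measure \<rightarrow>\<^sub>M ball_measure" for t
      using orthogonal_transformation_linear[OF orthogonal_phase_rotation]
      by (simp add: measurable_cong_sets[OF sets_ball_measure sets_ball_measure]
        borel_measurable_continuous_onI linear_continuous_on linear_conv_bounded_linear)
    show "distr ball_measure ball_measure (phase_rotation t) = ball_measure" for t
      by (rule distr_ball_measure_orthogonal) (rule orthogonal_phase_rotation)
    show "AE y in ball_measure. complex_form P y \<noteq> 0 \<and> complex_form Q y \<noteq> 0"
      using nz by (rule eventually_mono) simp
  qed (auto simp: complex_form_phase_rotation)
  also have "\<dots> = arccos (covector P \<bullet> covector Q)"
    unfolding Re_complex_form using P Q crofton[of "covector P" "covector Q"] by (simp add: norm_covector)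
  finally show ?thesis
    by (simp add: inner_covector sphere_dist_def)
qed

text \<open>For \<open>P $ 3 = 0\<close> the form is \<open>fst_complex y * p\<close>, and the
  factor \<open>cnj (fst_complex y)\<close> turns it into a positive multiple of
  \<open>p\<close>.\<close>

lemma AE_shadow_boundary:
  assumes "P \<in> boundary_circle"
  shows "AE y in ball_measure. shadow P y = P"
  using AE_fst_complex_nonzero
proof (rule eventually_mono)
  fix y assume y: "fst_complex y \<noteq> 0"
  define p where "p = Complex (P $ 1) (P $ 2)"
  have P3: "P $ 3 = 0" and "norm P = 1" using assms by (auto simp: boundary_circle_def)
  then have p: "cmod p = 1"
    by (simp add: p_def cmod_def norm_eq_sqrt_inner inner_vec_def sum_3 power2_eq_square)
  have "sgn (complex_form P y * cnj (fst_complex y)) = sgn (p * of_real ((cmod (fst_complex y))\<^sup>2))"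
    by (simp add: complex_form_def P3 p_def complex_norm_square mult_ac del: of_real_power)
  also have "\<dots> = p"
  proof -
    have "sgn (complex_of_real ((cmod (fst_complex y))\<^sup>2)) = 1"
      using y by (simp add: sgn_of_real del: of_real_power)
    moreover have "sgn p = p" using p by (simp add: sgn_div_norm)
    ultimately show ?thesis by (simp add: sgn_mult del: of_real_power)
  qed
  finally have "sgn (complex_form P y * cnj (fst_complex y)) = p" .
  moreover from this p have "complex_form P y * cnj (fst_complex y) \<noteq> 0" by (auto simp: sgn_zero_iff)
  ultimately show "shadow P y = P"
    by (simp add: vec_eq_iff forall_3 shadow_def circle_point_nth P3 p_def)
qed

section \<open>Spherical triangle inequality and geodesics\<close>

text \<open>Expanding \<open>a\<close> and \<open>c\<close> along great circles from
  \<open>b\<close> gives the spherical law of cosines. Since \<open>n \<bullet> m\<close> is at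
  least -1, \<open>a \<bullet> c\<close> is at least \<open>cos (s + t)\<close>. If the right side
  exceeds \<open>pi\<close> the bound is trivial.\<close>

lemma arccos_inner_triangle:
  fixes a b c :: "'a::euclidean_space"
  assumes a: "norm a = 1" and b: "norm b = 1" and c: "norm c = 1" and dim: "2 \<le> DIM('a)"
  shows "arccos (a \<bullet> c) \<le> arccos (a \<bullet> b) + arccos (b \<bullet> c)"
proof (cases "arccos (a \<bullet> b) + arccos (b \<bullet> c) \<le> pi")
  case True
  define s where "s = arccos (b \<bullet> a)"
  define t where "t = arccos (b \<bullet> c)"
  have st: "0 \<le> s" "0 \<le> t" "s \<le> pi" "t \<le> pi" "s + t \<le> pi"
    using abs_inner_unit[OF b a] abs_inner_unit[OF b c] True
    by (auto simp: s_def t_def arccos_lbound arccos_ubound inner_commute)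
  obtain n where n: "norm n = 1" "b \<bullet> n = 0" "a = cos s *\<^sub>R b + sin s *\<^sub>R n"
    unfolding s_def by (rule unit_great_circle[OF b a dim])
  obtain m where m: "norm m = 1" "b \<bullet> m = 0" "c = cos t *\<^sub>R b + sin t *\<^sub>R m"
    unfolding t_def by (rule unit_great_circle[OF b c dim])
  have "b \<bullet> b = 1" using b by (simp add: dot_square_norm)
  then have "a \<bullet> c = cos s * cos t + (sin s * sin t) * (n \<bullet> m)"
    using n(2) m(2)
    by (subst n(3), subst m(3)) (simp add: inner_add_left inner_add_right inner_commute)
  moreover have "(sin s * sin t) * - 1 \<le> (sin s * sin t) * (n \<bullet> m)"
    using abs_inner_unit[OF n(1) m(1)] st by (intro mult_left_mono) (auto simp: sin_ge_zero)
  ultimately have "cos (s + t) \<le> a \<bullet> c"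
    by (simp add: cos_add)
  then have "arccos (a \<bullet> c) \<le> arccos (cos (s + t))"
    using abs_inner_unit[OF a c] by (intro arccos_le_arccos) auto
  then show ?thesis
    using st by (simp add: arccos_cos s_def t_def inner_commute)
next
  case False
  then show ?thesis
    using abs_inner_unit[OF a c] arccos_ubound[of "a \<bullet> c"] by (simp add: abs_le_iff)
qed

lemma sphere_dist_triangle:
  assumes "norm x = 1" "norm y = 1" "norm z = 1"
  shows "sphere_dist x z \<le> sphere_dist x y + sphere_dist y z"
  unfolding sphere_dist_def by (rule arccos_inner_triangle) (use assms in auto)

text \<open>Prolong the geodesic from \<open>Q\<close> to \<open>P\<close> beyond \<open>P\<close>: it meets the equator no later than at \<open>- Q\<close>.\<close>
lemma geodesic_endpoint:
  assumes P: "P \<in> hemisphere" and Q: "Q \<in> hemisphere"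
  obtains A where "A \<in> boundary_circle" "sphere_dist A Q = sphere_dist A P + sphere_dist P Q"
proof -
  define d where "d = arccos (P \<bullet> Q)"
  have nP: "norm P = 1" and nQ: "norm Q = 1" using P Q by (auto simp: hemisphere_unit)
  have d: "0 \<le> d" "d \<le> pi"
    using sphere_dist_bounds[OF nP nQ] by (auto simp: d_def sphere_dist_def)
  obtain n where n: "norm n = 1" "P \<bullet> n = 0" and Qn: "Q = cos d *\<^sub>R P + sin d *\<^sub>R n"
    unfolding d_def by (rule unit_great_circle[OF nP nQ]) auto
  have one: "P \<bullet> P = 1" "n \<bullet> n = 1" "n \<bullet> P = 0"
    using nP n by (auto simp: dot_square_norm inner_commute)
  define \<gamma> where "\<gamma> t = cos t *\<^sub>R P + sin t *\<^sub>R n" for t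
  \<comment> \<open>Negative \<open>t\<close> leads from \<open>P\<close> away from
    \<open>Q\<close>. At \<open>d - pi\<close> the curve is at \<open>- Q\<close>, on or below the
    equator, while \<open>P\<close> is on or above it.\<close>
  have "\<exists>t\<ge>d - pi. t \<le> 0 \<and> \<gamma> t $ 3 = 0"
  proof (rule IVT')
    have "\<gamma> (d - pi) = - Q" by (simp add: \<gamma>_def Qn)
    then show "\<gamma> (d - pi) $ 3 \<le> 0" using Q by (simp add: hemisphere_def)
    show "0 \<le> \<gamma> 0 $ 3" using P by (simp add: \<gamma>_def hemisphere_def)
    show "continuous_on {d - pi..0} (\<lambda>t. \<gamma> t $ 3)"
      unfolding \<gamma>_def by (intro continuous_intros)
  qed (use d in auto)
  then obtain t where t: "d - pi \<le> t" "t \<le> 0" "\<gamma> t $ 3 = 0" by auto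
  have "\<gamma> t \<bullet> \<gamma> t = (cos t)\<^sup>2 + (sin t)\<^sup>2"
    using one n(2) by (simp add: \<gamma>_def inner_add_left inner_add_right power2_eq_square)
  then have "norm (\<gamma> t) = 1" by (simp add: norm_eq_sqrt_inner)
  then have "\<gamma> t \<in> boundary_circle" using t(3) by (simp add: boundary_circle_def)
  moreover have "\<gamma> t \<bullet> P = cos t" 
    using one by (simp add: \<gamma>_def inner_add_left)
  moreover have "\<gamma> t \<bullet> Q = cos (d - t)"
    unfolding Qn \<gamma>_def using one n(2) by (simp add: inner_add_left inner_add_right cos_diff)
  \<comment> \<open>The distances to \<open>P\<close> and \<open>Q\<close> are \<open>- t\<close>
    and \<open>d - t\<close>; the bound \<open>d - pi \<le> t\<close> keeps the latter within the
    range of \<open>arccos\<close>.\<close>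
  ultimately show thesis
    using that[of "\<gamma> t"] t d by (simp add: sphere_dist_def arccos_cos arccos_cos2 flip: d_def)
qed

section \<open>Wasserstein distances of the image measures\<close>

lemma embedding_in_circle_probs: "embedding P \<in> circle_probs"
  by (simp add: circle_probs_def embedding_def ball_measure.prob_space_distr)

text \<open>\<open>A\<close> is almost surely its own shadow, so the mean distance from
  \<open>A\<close> is that of a pair of shadows.\<close>

lemma integral_embedding:
  assumes A: "A \<in> boundary_circle" and P: "norm P = 1"
  shows "integral\<^sup>L (embedding P) (sphere_dist A) = sphere_dist A P"
proof -
  have mA: "(\<lambda>x. A) \<in> M \<rightarrow>\<^sub>M circle_borel" for M :: "'c measure"
    using A by simp
  have "integral\<^sup>L (embedding P) (sphere_dist A)
      = ball_measure.expectation (\<lambda>y. sphere_dist A (shadow P y))"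
    unfolding embedding_def
    using measurable_sphere_dist[OF mA measurable_ident] by (subst integral_distr) auto
  also have "\<dots> = ball_measure.expectation (\<lambda>y. sphere_dist (shadow A y) (shadow P y))"
  proof (rule integral_cong_AE)
    show "AE y in ball_measure. sphere_dist A (shadow P y) = sphere_dist (shadow A y) (shadow P y)"
      using AE_shadow_boundary[OF A] by (rule eventually_mono) simp
  qed (intro measurable_sphere_dist mA measurable_shadow)+
  also have "\<dots> = sphere_dist A P"
    using A P by (intro expectation_sphere_dist_shadow) (auto simp: circle_unit)
  finally show ?thesis .
qed

text \<open>The easy half of Kantorovich duality: the integrals of the 1-Lipschitz function
  \<open>sphere_dist A\<close> over the two coordinates are fixed by the marginals of
  \<open>K\<close>.\<close>

lemma coupling_cost_ge:
  assumes K: "K \<in> couplings (embedding P) (embedding Q)"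
    and A: "A \<in> boundary_circle" and P: "norm P = 1" and Q: "norm Q = 1"
  shows "sphere_dist A Q - sphere_dist A P \<le> integral\<^sup>L K (\<lambda>z. sphere_dist (fst z) (snd z))"
proof -
  interpret K: prob_space K using K by (simp add: couplings_def)
  have [measurable_cong]: "sets K = sets (circle_borel \<Otimes>\<^sub>M circle_borel)"
    and K1: "distr K circle_borel fst = embedding P" and K2: "distr K circle_borel snd = embedding Q"
    using K by (simp_all add: couplings_def)
  have m: "fst \<in> K \<rightarrow>\<^sub>M circle_borel" "snd \<in> K \<rightarrow>\<^sub>M circle_borel"
    by measurable
  have mA: "(\<lambda>x. A) \<in> M \<rightarrow>\<^sub>M circle_borel" for M :: "'c measure"
    using A by simp
  have mdA: "sphere_dist A \<in> borel_measurable circle_borel"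
    using measurable_sphere_dist[OF mA measurable_ident] by simp
  have int: "integrable K (\<lambda>z. sphere_dist A (fst z))" "integrable K (\<lambda>z. sphere_dist A (snd z))"
    by (intro integrable_sphere_dist K.prob_space_axioms mA m)+
  have "sphere_dist A Q - sphere_dist A P
      = integral\<^sup>L K (\<lambda>z. sphere_dist A (snd z)) - integral\<^sup>L K (\<lambda>z. sphere_dist A (fst z))"
    using integral_distr[OF m(1) mdA] integral_distr[OF m(2) mdA]
      integral_embedding[OF A P] integral_embedding[OF A Q] by (simp add: K1 K2)
  also have "\<dots> = integral\<^sup>L K (\<lambda>z. sphere_dist A (snd z) - sphere_dist A (fst z))"
    using int by simp
  also have "\<dots> \<le> integral\<^sup>L K (\<lambda>z. sphere_dist (fst z) (snd z))"
  proof (rule integral_mono)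
    show "integrable K (\<lambda>z. sphere_dist (fst z) (snd z))"
      by (intro integrable_sphere_dist K.prob_space_axioms m)
    fix z assume "z \<in> space K"
    then have "norm (fst z) = 1" "norm (snd z) = 1"
      using m[THEN measurable_space] by (auto simp: circle_unit)
    then show "sphere_dist A (snd z) - sphere_dist A (fst z) \<le> sphere_dist (fst z) (snd z)"
      using sphere_dist_triangle[of A "fst z" "snd z"] circle_unit[OF A] by simp
  qed (use int in simp)
  finally show ?thesis .
qed

definition shadow_coupling :: "real^3 \<Rightarrow> real^3 \<Rightarrow> ((real^3) \<times> (real^3)) measure" where
  "shadow_coupling P Q =
    distr ball_measure (circle_borel \<Otimes>\<^sub>M circle_borel) (\<lambda>y. (shadow P y, shadow Q y))"

lemma shadow_coupling_in_couplings:
  "shadow_coupling P Q \<in> couplings (embedding P) (embedding Q)"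
  unfolding couplings_def shadow_coupling_def embedding_def
  by (auto simp: distr_distr comp_def intro!: ball_measure.prob_space_distr)

lemma shadow_coupling_cost:
  assumes "norm P = 1" "norm Q = 1"
  shows "integral\<^sup>L (shadow_coupling P Q) (\<lambda>z. sphere_dist (fst z) (snd z)) = sphere_dist P Q"
  unfolding shadow_coupling_def
  using measurable_sphere_dist[OF measurable_fst measurable_snd] expectation_sphere_dist_shadow[OF assms]
  by (subst integral_distr) auto

text \<open>The infimum is attained by \<open>shadow_coupling P Q\<close>; the matching lower bound
  is \<open>coupling_cost_ge\<close> at the endpoint from \<open>geodesic_endpoint\<close>, where
  the triangle inequality is an equality.\<close>

lemma wasserstein1_embedding:
  assumes P: "P \<in> hemisphere" and Q: "Q \<in> hemisphere"
  shows "wasserstein1 (embedding P) (embedding Q) = sphere_dist P Q"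
  unfolding wasserstein1_def
proof (rule cInf_eq_minimum)
  show "sphere_dist P Q \<in> (\<lambda>K. integral\<^sup>L K (\<lambda>z. sphere_dist (fst z) (snd z)))
      ` couplings (embedding P) (embedding Q)"
    using shadow_coupling_cost[of P Q] P Q
    by (intro image_eqI[OF _ shadow_coupling_in_couplings]) (simp add: hemisphere_unit)
  fix c assume "c \<in> (\<lambda>K. integral\<^sup>L K (\<lambda>z. sphere_dist (fst z) (snd z)))
      ` couplings (embedding P) (embedding Q)"
  then obtain K where K: "K \<in> couplings (embedding P) (embedding Q)"
    and c: "c = integral\<^sup>L K (\<lambda>z. sphere_dist (fst z) (snd z))" by auto
  obtain A where A: "A \<in> boundary_circle" "sphere_dist A Q = sphere_dist A P + sphere_dist P Q"
    using geodesic_endpoint[OF P Q] .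
  show "sphere_dist P Q \<le> c"
    using coupling_cost_ge[OF K A(1)] A(2) P Q by (simp add: c hemisphere_unit)
qed

lemma embedding_boundary:
  assumes "P \<in> boundary_circle"
  shows "embedding P = return circle_borel P"
proof -
  have "embedding P = distr ball_measure circle_borel (\<lambda>_ :: real^4. P)"
    unfolding embedding_def
    by (rule distr_cong_AE[OF refl refl AE_shadow_boundary[OF assms]]) (use assms in simp_all)
  also have "\<dots> = return circle_borel P"
    using assms by (intro ball_measure.distr_const) auto
  finally show ?thesis .
qed

theorem proposition1p5:
  "\<exists>\<iota> :: real ^ 3 \<Rightarrow> (real ^ 3) measure.
     (\<forall>P \<in> hemisphere. \<iota> P \<in> circle_probs) \<and>
     (\<forall>P \<in> hemisphere. \<forall>Q \<in> hemisphere. wasserstein1 (\<iota> P) (\<iota> Q) = sphere_dist P Q) \<and>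
     (\<forall>P \<in> boundary_circle. \<iota> P = return circle_borel P)"
  by (rule exI[of _ embedding])
    (simp add: embedding_in_circle_probs wasserstein1_embedding embedding_boundary)

end
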